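(* Let $\mathcal{F}$ be a family of entire functions such that $f\circ g=g\circ f$ for all $f,g\in\mathcal{F}$. Then the escaping like set $I(\mathcal{F})$ and the generalized escaping like set $U(\mathcal{F})$ are backward invariant.
   Context: For a family $\mathcal{F}$ of holomorphic functions on a domain $D\subseteq\mathbb{C}$ (here $D=\mathbb{C}$), an infinite sequence in $\mathcal{F}$ means a sequence $\{f_n\}\subset\mathcal{F}$ with $f_m\neq f_n$ for $m\neq n$. The escaping like set is $I(\mathcal{F}):=\{z\in D: f_n(z)\to\infty \text{ for every infinite sequence } \{f_n\} \text{ in } \mathcal{F}\}$, and the generalized escaping like set is $U(\mathcal{F}):=\{z\in D: f_n(z)\to\infty \text{ for some sequence } \{f_n\}\text{ in }\mathcal{F}\}$. A set $S\subseteq\mathbb{C}$ is backward invariant (with respect to $\mathcal{F}$) if $f^{-1}(S)\subseteq S$ for every $f\in\mathcal{F}$. *)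

theory Defs
  imports "HOL-Complex_Analysis.Complex_Analysis"
begin

text \<open>Families are sets of total functions, so for domain \<open>\<complex>\<close> the pairwise distinctness of the
  members of an infinite sequence is injectivity of the sequence.\<close>

definition infinite_sequence_in :: "(complex \<Rightarrow> complex) set \<Rightarrow> (nat \<Rightarrow> complex \<Rightarrow> complex) \<Rightarrow> bool" where
  "infinite_sequence_in F s \<longleftrightarrow> range s \<subseteq> F \<and> inj s"

definition escaping_like_set :: "(complex \<Rightarrow> complex) set \<Rightarrow> complex set" where
  "escaping_like_set F =
     {z. \<forall>s. infinite_sequence_in F s \<longrightarrow> filterlim (\<lambda>n. s n z) at_infinity sequentially}"

text \<open>Here the sequence is an arbitrary one; this agrees with asking for an infinite sequence, since
  a sequence with \<open>s n z \<rightarrow> \<infinity>\<close> visits each member of the family only finitely often, and so has an injective subsequence.\<close>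

definition generalized_escaping_like_set :: "(complex \<Rightarrow> complex) set \<Rightarrow> complex set" where
  "generalized_escaping_like_set F =
     {z. \<exists>s. range s \<subseteq> F \<and> filterlim (\<lambda>n. s n z) at_infinity sequentially}"

definition backward_invariant :: "(complex \<Rightarrow> complex) set \<Rightarrow> complex set \<Rightarrow> bool" where
  "backward_invariant F S \<longleftrightarrow> (\<forall>f\<in>F. f -` S \<subseteq> S)"

end

theory Submission
  imports Defs
begin

text \<open>For f and all s n in the family, commutation gives s n (f z) = f (s n z). If the left
  side tends to infinity, so does f along the points s n z, and these must then tend to infinity
  themselves, since f is bounded on bounded sets. So every sequence in the family that escapes at f
  z escapes at z, which settles both sets at once.\<close>

text \<open>By Heine-Borel, a continuous f is bounded on each closed ball; wherever
  \<open>f (w n)\<close> exceeds that bound, \<open>w n\<close> lies outside the ball.\<close>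

lemma filterlim_at_infinity_continuous_preimage:
  fixes f :: "'a::{real_normed_vector, heine_borel} \<Rightarrow> 'b::real_normed_vector"
  assumes cont: "continuous_on UNIV f"
    and lim: "filterlim (\<lambda>n. f (w n)) at_infinity G"
  shows "filterlim w at_infinity G"
proof -
  have "eventually (\<lambda>n. norm (w n) \<ge> r) G" for r
  proof -
    have "compact (f ` cball 0 r)"
      using continuous_on_subset[OF cont] by (intro compact_continuous_image) auto
    then have "bounded (f ` cball 0 r)"
      by (rule compact_imp_bounded)
    then obtain M where M: "\<And>x. x \<in> cball 0 r \<Longrightarrow> norm (f x) \<le> M"
      unfolding bounded_iff by blast
    have "eventually (\<lambda>n. norm (f (w n)) > M) G"
      using filterlim_at_infinity_imp_norm_at_top[OF lim] by (simp add: filterlim_at_top_dense)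
    then show ?thesis
      proof eventually_elim
      case (elim n)
      then have "w n \<notin> cball 0 r"
        using M[of "w n"] by linarith
      then show ?case
        by simp
    qed
  qed
  then show ?thesis
    by (simp add: filterlim_at_infinity[of 0])
qed

theorem theorem3p5:
  fixes F :: "(complex \<Rightarrow> complex) set"
  assumes entire: "\<And>f. f \<in> F \<Longrightarrow> f holomorphic_on UNIV"
    and commute: "\<And>f g. f \<in> F \<Longrightarrow> g \<in> F \<Longrightarrow> f \<circ> g = g \<circ> f"
  shows "backward_invariant F (escaping_like_set F) \<and>
         backward_invariant F (generalized_escaping_like_set F)"
proof -
  \<comment> \<open>The sequence s is the same at f z and at z, so this fits either quantifier over
    sequences, and injectivity of s carries over unchanged.\<close>
  have pull: "filterlim (\<lambda>n. s n z) at_infinity sequentially"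
    if f: "f \<in> F" and s: "range s \<subseteq> F"
      and lim: "filterlim (\<lambda>n. s n (f z)) at_infinity sequentially" for f s z
  proof (rule filterlim_at_infinity_continuous_preimage)
    show "continuous_on UNIV f"
      using entire[OF f] by (rule holomorphic_on_imp_continuous_on)
    have "s n (f z) = f (s n z)" for n
      using commute[OF f, of "s n"] s by (metis comp_apply rangeI subsetD)
    with lim show "filterlim (\<lambda>n. f (s n z)) at_infinity sequentially"
      by simp
  qed
  have "z \<in> escaping_like_set F" if "f \<in> F" "f z \<in> escaping_like_set F" for f z
    using that pull[OF that(1)] by (simp add: escaping_like_set_def infinite_sequence_in_def)
  \<comment> \<open>The witness sequence for f z also serves as witness for z.\<close>
  moreover have "z \<in> generalized_escaping_like_set F"
    if "f \<in> F" "f z \<in> generalized_escaping_like_set F" for f z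
    using that pull[OF that(1)] by (auto simp: generalized_escaping_like_set_def)
  ultimately show ?thesis
    by (auto simp: backward_invariant_def)
qed

end
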